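(* Let $c\neq0$ and $b$ be real constants and let $\widetilde X$ be the isothermic surface associated to the cylinder parametrized by $$\widetilde X=X-\frac{2}{2b+c(f-g)}\Big(f'X_{,1}+g'X_{,2}-gN\Big),$$ with $f,g$ as described in the context. Then $\widetilde X$ has constant mean curvature equal to $-\frac12$ if and only if $b=0$.
   Context: $X(u_1,u_2)=(\cos u_2,\sin u_2,u_1)$ is the cylinder, with inner unit normal $N=(-\cos u_2,-\sin u_2,0)$ and $X_{,i}=\partial X/\partial u_i$. The functions $f=f(u_1)$, $g=g(u_2)$ solve $f''-cf=b$, $g''+(1+c)g=b$, and satisfy $(f')^2-cf^2-2bf+(g')^2+(1+c)g^2-2bg=0$ at some point (hence everywhere). The surface $\widetilde X$ is considered on the (nonempty) set where $f+g\neq0$ and $2b+c(f-g)\neq0$, with unit normal $\widetilde N=N+\frac{2g}{(2b+c(f-g))(f+g)}(f'X_{,1}+g'X_{,2}-gN)$. Convention: $\widetilde\lambda_i$ are defined by $\widetilde N_{,i}=\widetilde\lambda_i\widetilde X_{,i}$, and the mean curvature is $\widetilde H=\frac12(\widetilde\lambda_1+\widetilde\lambda_2)$. *)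

theory Defs
  imports "HOL-Analysis.Analysis"
begin

definition partial1 :: "(real \<Rightarrow> real \<Rightarrow> 'a::real_normed_vector) \<Rightarrow> real \<Rightarrow> real \<Rightarrow> 'a" where
  "partial1 F u1 u2 = vector_derivative (\<lambda>t. F t u2) (at u1)"

definition partial2 :: "(real \<Rightarrow> real \<Rightarrow> 'a::real_normed_vector) \<Rightarrow> real \<Rightarrow> real \<Rightarrow> 'a" where
  "partial2 F u1 u2 = vector_derivative (\<lambda>t. F u1 t) (at u2)"

text \<open>
  For a surface \<open>X\<close> with unit normal \<open>N\<close> whose coordinate curves are lines of curvature,
  the principal curvatures are given by \<open>N\<^sub>,\<^sub>i = \<lambda>\<^sub>i X\<^sub>,\<^sub>i\<close>. There is no minus sign here: the unit
  cylinder with inner normal has curvatures \<open>0\<close> and \<open>-1\<close>. The value is meaningful only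
  where \<open>X\<^sub>,\<^sub>i \<noteq> 0\<close> and \<open>N\<^sub>,\<^sub>i\<close> is a multiple of \<open>X\<^sub>,\<^sub>i\<close>.
\<close>

definition principal_curvature1 ::
    "(real \<Rightarrow> real \<Rightarrow> real^3) \<Rightarrow> (real \<Rightarrow> real \<Rightarrow> real^3) \<Rightarrow> real \<Rightarrow> real \<Rightarrow> real" where
  "principal_curvature1 X N u1 u2 = (THE l. partial1 N u1 u2 = l *\<^sub>R partial1 X u1 u2)"

definition principal_curvature2 ::
    "(real \<Rightarrow> real \<Rightarrow> real^3) \<Rightarrow> (real \<Rightarrow> real \<Rightarrow> real^3) \<Rightarrow> real \<Rightarrow> real \<Rightarrow> real" where
  "principal_curvature2 X N u1 u2 = (THE l. partial2 N u1 u2 = l *\<^sub>R partial2 X u1 u2)"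

definition mean_curvature ::
    "(real \<Rightarrow> real \<Rightarrow> real^3) \<Rightarrow> (real \<Rightarrow> real \<Rightarrow> real^3) \<Rightarrow> real \<Rightarrow> real \<Rightarrow> real" where
  "mean_curvature X N u1 u2 =
     (1/2) * (principal_curvature1 X N u1 u2 + principal_curvature2 X N u1 u2)"

definition cyl :: "real \<Rightarrow> real \<Rightarrow> real^3" where
  "cyl u1 u2 = vector [cos u2, sin u2, u1]"

definition cyl_normal :: "real \<Rightarrow> real \<Rightarrow> real^3" where
  "cyl_normal u1 u2 = vector [- cos u2, - sin u2, 0]"

definition tilde_dir :: "(real \<Rightarrow> real) \<Rightarrow> (real \<Rightarrow> real) \<Rightarrow> real \<Rightarrow> real \<Rightarrow> real^3" where
  "tilde_dir f g u1 u2 =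
     deriv f u1 *\<^sub>R partial1 cyl u1 u2 + deriv g u2 *\<^sub>R partial2 cyl u1 u2
       - g u2 *\<^sub>R cyl_normal u1 u2"

definition tilde_surface ::
    "real \<Rightarrow> real \<Rightarrow> (real \<Rightarrow> real) \<Rightarrow> (real \<Rightarrow> real) \<Rightarrow> real \<Rightarrow> real \<Rightarrow> real^3" where
  "tilde_surface b c f g u1 u2 =
     cyl u1 u2 - (2 / (2*b + c * (f u1 - g u2))) *\<^sub>R tilde_dir f g u1 u2"

definition tilde_normal ::
    "real \<Rightarrow> real \<Rightarrow> (real \<Rightarrow> real) \<Rightarrow> (real \<Rightarrow> real) \<Rightarrow> real \<Rightarrow> real \<Rightarrow> real^3" where
  "tilde_normal b c f g u1 u2 =
     cyl_normal u1 u2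
       + (2 * g u2 / ((2*b + c * (f u1 - g u2)) * (f u1 + g u2))) *\<^sub>R tilde_dir f g u1 u2"

definition tilde_domain ::
    "real \<Rightarrow> real \<Rightarrow> (real \<Rightarrow> real) \<Rightarrow> (real \<Rightarrow> real) \<Rightarrow> (real \<times> real) set" where
  "tilde_domain b c f g =
     {(u1, u2). f u1 + g u2 \<noteq> 0 \<and> 2*b + c * (f u1 - g u2) \<noteq> 0}"

definition solves_ode2 :: "real \<Rightarrow> real \<Rightarrow> (real \<Rightarrow> real) \<Rightarrow> bool" where
  "solves_ode2 k b f \<longleftrightarrow>
     (\<forall>t. f differentiable (at t) \<and> deriv f differentiable (at t)
        \<and> deriv (deriv f) t + k * f t = b)"

end

theory Submission
  imports Defs
begin

text \<open>
  The mean curvature of the associated surface has a closed form that holds at every point of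
  the domain:
  \<open>H = - 1/2 - b / (c (f + g))\<close>,
  so at any single point of the domain it equals \<open>- 1/2\<close> exactly when \<open>b = 0\<close>. The domain is
  nonempty, and the equivalence follows.

  Write \<open>M = f + g\<close>, \<open>D = 2 b + c (f - g)\<close> and \<open>V = f' X\<^sub>,\<^sub>1 + g' X\<^sub>,\<^sub>2 - g N\<close>. The two differential
  equations turn each partial derivative of \<open>V\<close> into a multiple of the frame vector in the
  same direction, \<open>V\<^sub>,\<^sub>1 = (b + c f) X\<^sub>,\<^sub>1\<close> and
  \<open>V\<^sub>,\<^sub>2 = (b - c g) X\<^sub>,\<^sub>2\<close>. Consequently both the surface \<open>X - (2/D) V\<close> and its normal
  \<open>N + (2 g / (D M)) V\<close> have \<open>i\<close>-th partial derivative along one common vector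
  \<open>W\<^sub>i = M X\<^sub>,\<^sub>i - (2 h\<^sub>i / D) V\<close>, where \<open>h\<^sub>1 = f'\<close> and \<open>h\<^sub>2 = g'\<close>, and the principal curvatures
  are the quotients of the factors:
  \<open>\<lambda>\<^sub>1 = - 2 g (b + c f) / (c M\<^sup>2)\<close> and \<open>\<lambda>\<^sub>2 = - (D M - 2 g (b - c g)) / (c M\<^sup>2)\<close>.
  In their sum a factor \<open>M\<close> cancels and the formula for \<open>H\<close> remains.

  The quotients only determine the curvatures if \<open>W\<^sub>i \<noteq> 0\<close>. This is the role of the normalization
  of the first integrals: it is equivalent to \<open>V \<bullet> V = M D\<close>, from which \<open>W\<^sub>i \<bullet> W\<^sub>i = M\<^sup>2\<close>.
\<close>

section \<open>The moving frame of the cylinder\<close>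

definition axial_dir :: "real^3" where
  "axial_dir = vector [0, 0, 1]"

definition angular_dir :: "real \<Rightarrow> real^3" where
  "angular_dir u = vector [- sin u, cos u, 0]"

lemma has_vector_derivative_vector_3:
  assumes "(x has_real_derivative x') (at t)"
    and "(y has_real_derivative y') (at t)"
    and "(z has_real_derivative z') (at t)"
  shows "((\<lambda>s. vector [x s, y s, z s] :: real^3) has_vector_derivative vector [x', y', z']) (at t)"
proof -
  have split: "(vector [p, q, r] :: real^3) = p *\<^sub>R axis 1 1 + q *\<^sub>R axis 2 1 + r *\<^sub>R axis 3 1"
    for p q r :: real
    by (simp add: vec_eq_iff forall_3 axis_def)
  have scaled: "((\<lambda>s. w s *\<^sub>R v) has_vector_derivative w' *\<^sub>R v) (at t)"
    if "(w has_real_derivative w') (at t)" for w w' and v :: "real^3"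
    using has_vector_derivative_scaleR[OF that has_vector_derivative_const[of v]] by simp
  show ?thesis
    unfolding split by (intro has_vector_derivative_add scaled assms)
qed

lemma cyl_has_vector_derivative_axial:
  "((\<lambda>t. cyl t u2) has_vector_derivative axial_dir) (at u1)"
  unfolding cyl_def axial_dir_def
  by (intro has_vector_derivative_vector_3 derivative_intros)

lemma partial1_cyl: "partial1 cyl u1 u2 = axial_dir"
  unfolding partial1_def
  by (intro vector_derivative_at cyl_has_vector_derivative_axial)

lemma cyl_has_vector_derivative_angular:
  "((\<lambda>t. cyl u1 t) has_vector_derivative angular_dir u2) (at u2)"
  unfolding cyl_def angular_dir_def
  by (intro has_vector_derivative_vector_3) (auto intro!: derivative_eq_intros)

lemma partial2_cyl: "partial2 cyl u1 u2 = angular_dir u2"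
  unfolding partial2_def
  by (intro vector_derivative_at cyl_has_vector_derivative_angular)

lemma angular_dir_has_vector_derivative:
  "(angular_dir has_vector_derivative cyl_normal u1 u2) (at u2)"
  unfolding cyl_normal_def angular_dir_def
  by (intro has_vector_derivative_vector_3) (auto intro!: derivative_eq_intros)

lemma cyl_normal_has_vector_derivative_axial:
  "((\<lambda>t. cyl_normal t u2) has_vector_derivative 0) (at u1)"
  by (simp add: cyl_normal_def)

lemma cyl_normal_has_vector_derivative_angular:
  "((\<lambda>t. cyl_normal u1 t) has_vector_derivative - angular_dir u2) (at u2)"
proof -
  have "- angular_dir u2 = vector [sin u2, - cos u2, 0]"
    by (simp add: angular_dir_def vec_eq_iff forall_3)
  then show ?thesis
    unfolding cyl_normal_def
    by (simp only:) (intro has_vector_derivative_vector_3; auto intro!: derivative_eq_intros)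
qed

lemma cylinder_frame_orthonormal:
  "axial_dir \<bullet> axial_dir = 1" "angular_dir u2 \<bullet> angular_dir u2 = 1"
  "cyl_normal u1 u2 \<bullet> cyl_normal u1 u2 = 1"
  "axial_dir \<bullet> angular_dir u2 = 0" "axial_dir \<bullet> cyl_normal u1 u2 = 0"
  "angular_dir u2 \<bullet> cyl_normal u1 u2 = 0"
  using sin_cos_squared_add[of u2]
  by (simp_all add: axial_dir_def angular_dir_def cyl_normal_def inner_vec_def sum_3
      power2_eq_square)

section \<open>Curvature quotients and first integrals\<close>

text \<open>
  The definite description in the principal curvatures is pinned down as soon as both
  partial derivatives are known multiples of one nonzero vector.
\<close>

lemma the_scaleR_ratio:
  fixes w :: "'a::real_vector"
  assumes "w \<noteq> 0" "k \<noteq> 0"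
  shows "(THE l. m *\<^sub>R w = l *\<^sub>R (k *\<^sub>R w)) = m / k"
  using assms by (intro the_equality) (auto simp: field_simps)

text \<open>
  The derivative of the quadratic expression is \<open>2 h' (h'' + k h - b)\<close>.
\<close>

lemma solves_ode2_first_integral:
  assumes "solves_ode2 k b h"
  shows "(deriv h s)^2 + k * (h s)^2 - 2 * b * h s = (deriv h t)^2 + k * (h t)^2 - 2 * b * h t"
proof -
  have h: "(h has_real_derivative deriv h u) (at u)" for u
    using assms by (auto simp: solves_ode2_def DERIV_deriv_iff_real_differentiable)
  have "(deriv h has_real_derivative deriv (deriv h) u) (at u)" for u
    using assms by (auto simp: solves_ode2_def DERIV_deriv_iff_real_differentiable)
  moreover have "deriv (deriv h) u = b - k * h u" for u
    using assms by (simp add: solves_ode2_def eq_diff_eq)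
  ultimately have h': "(deriv h has_real_derivative b - k * h u) (at u)" for u
    by simp
  have "((\<lambda>u. (deriv h u)^2 + k * (h u)^2 - 2 * b * h u) has_real_derivative 0) (at u)" for u
    by (auto intro!: derivative_eq_intros h h' simp: algebra_simps)
  then show ?thesis
    by (intro DERIV_isconst_all) auto
qed

section \<open>The deformation vector field\<close>

locale cylinder_isothermic_data =
  fixes b c :: real and f g :: "real \<Rightarrow> real"
  assumes c_nonzero: "c \<noteq> 0"
    and f_ode: "solves_ode2 (- c) b f"
    and g_ode: "solves_ode2 (1 + c) b g"
    and integral: "\<exists>u1 u2. (deriv f u1)^2 - c * (f u1)^2 - 2 * b * f u1
               + (deriv g u2)^2 + (1 + c) * (g u2)^2 - 2 * b * g u2 = 0"
begin

definition D :: "real \<Rightarrow> real \<Rightarrow> real" where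
  "D u1 u2 = 2*b + c * (f u1 - g u2)"

definition M :: "real \<Rightarrow> real \<Rightarrow> real" where
  "M u1 u2 = f u1 + g u2"

abbreviation V :: "real \<Rightarrow> real \<Rightarrow> real^3" where
  "V \<equiv> tilde_dir f g"

text \<open>
  Up to the factor \<open>M\<close>, these are the images of the frame vectors \<open>X\<^sub>,\<^sub>1\<close> and \<open>X\<^sub>,\<^sub>2\<close> under
  the reflection in the plane orthogonal to \<open>V\<close>, since \<open>V \<bullet> V = M D\<close>.
\<close>

definition W1 :: "real \<Rightarrow> real \<Rightarrow> real^3" where
  "W1 u1 u2 = M u1 u2 *\<^sub>R axial_dir - (2 * deriv f u1 / D u1 u2) *\<^sub>R V u1 u2"

definition W2 :: "real \<Rightarrow> real \<Rightarrow> real^3" where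
  "W2 u1 u2 = M u1 u2 *\<^sub>R angular_dir u2 - (2 * deriv g u2 / D u1 u2) *\<^sub>R V u1 u2"

lemma V_eq:
  "V u1 u2 = deriv f u1 *\<^sub>R axial_dir + deriv g u2 *\<^sub>R angular_dir u2 - g u2 *\<^sub>R cyl_normal u1 u2"
  by (simp add: tilde_dir_def partial1_cyl partial2_cyl)

lemma has_derivs:
  shows f_deriv: "(f has_real_derivative deriv f u) (at u)"
    and g_deriv: "(g has_real_derivative deriv g u) (at u)"
    and f'_deriv: "(deriv f has_real_derivative b + c * f u) (at u)"
    and g'_deriv: "(deriv g has_real_derivative b - (1 + c) * g u) (at u)"
proof -
  show "(f has_real_derivative deriv f u) (at u)" "(g has_real_derivative deriv g u) (at u)"
    using f_ode g_ode by (auto simp: solves_ode2_def DERIV_deriv_iff_real_differentiable)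
  have "deriv (deriv f) u = b + c * f u" "deriv (deriv g) u = b - (1 + c) * g u"
    using f_ode g_ode unfolding solves_ode2_def by (smt (verit) mult_minus_left)+
  then show "(deriv f has_real_derivative b + c * f u) (at u)"
      "(deriv g has_real_derivative b - (1 + c) * g u) (at u)"
    using f_ode g_ode by (metis solves_ode2_def DERIV_deriv_iff_real_differentiable)+
qed

text \<open>
  The normalization at one point propagates by the first integrals of the two equations, and
  rewrites the squared length in the factored form.
\<close>

lemma V_inner_V: "V u1 u2 \<bullet> V u1 u2 = M u1 u2 * D u1 u2"
proof -
  obtain s t where "(deriv f s)^2 - c * (f s)^2 - 2 * b * f s
               + (deriv g t)^2 + (1 + c) * (g t)^2 - 2 * b * g t = 0"
    using integral by blast
  then have "(deriv f u1)^2 - c * (f u1)^2 - 2 * b * f u1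
               + (deriv g u2)^2 + (1 + c) * (g u2)^2 - 2 * b * g u2 = 0"
    using solves_ode2_first_integral[OF f_ode, of s u1]
      solves_ode2_first_integral[OF g_ode, of t u2] by simp
  moreover have "V u1 u2 \<bullet> V u1 u2 = (deriv f u1)^2 + (deriv g u2)^2 + (g u2)^2"
    by (simp add: V_eq inner_simps cylinder_frame_orthonormal power2_eq_square
        inner_commute[of "angular_dir u2" axial_dir] inner_commute[of "cyl_normal u1 u2" axial_dir]
        inner_commute[of "cyl_normal u1 u2" "angular_dir u2"])
  ultimately show ?thesis
    by (simp add: M_def D_def power2_eq_square algebra_simps)
qed

lemma V_has_vector_derivative_1:
  "((\<lambda>t. V t u2) has_vector_derivative (b + c * f u1) *\<^sub>R axial_dir) (at u1)"
proof -
  have "((\<lambda>t. V t u2) has_vector_derivative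
      (deriv f u1 *\<^sub>R 0 + (b + c * f u1) *\<^sub>R axial_dir) + 0
        - (g u2 *\<^sub>R 0 + 0 *\<^sub>R cyl_normal u1 u2)) (at u1)"
    unfolding V_eq
    by (intro has_vector_derivative_diff has_vector_derivative_add has_vector_derivative_const
        has_vector_derivative_scaleR f'_deriv DERIV_const cyl_normal_has_vector_derivative_axial)
  then show ?thesis
    by simp
qed

text \<open>
  The normal components cancel: the rotation of \<open>X\<^sub>,\<^sub>2\<close> contributes \<open>g' N\<close>, and the
  coefficient of \<open>N\<close> contributes \<open>- g' N\<close>.
\<close>

lemma V_has_vector_derivative_2:
  "((\<lambda>t. V u1 t) has_vector_derivative (b - c * g u2) *\<^sub>R angular_dir u2) (at u2)"
proof -
  have "((\<lambda>t. V u1 t) has_vector_derivative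
      0 + (deriv g u2 *\<^sub>R cyl_normal u1 u2 + (b - (1 + c) * g u2) *\<^sub>R angular_dir u2)
        - (g u2 *\<^sub>R (- angular_dir u2) + deriv g u2 *\<^sub>R cyl_normal u1 u2)) (at u2)"
    unfolding V_eq
    by (intro has_vector_derivative_diff has_vector_derivative_add has_vector_derivative_const
        has_vector_derivative_scaleR g_deriv g'_deriv angular_dir_has_vector_derivative
        cyl_normal_has_vector_derivative_angular)
  also have "0 + (deriv g u2 *\<^sub>R cyl_normal u1 u2 + (b - (1 + c) * g u2) *\<^sub>R angular_dir u2)
        - (g u2 *\<^sub>R (- angular_dir u2) + deriv g u2 *\<^sub>R cyl_normal u1 u2)
      = (b - c * g u2) *\<^sub>R angular_dir u2"
    by (simp add: algebra_simps)
  finally show ?thesis .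
qed

section \<open>Partial derivatives of the associated surface and its normal\<close>

context
  fixes u1 u2 :: real
  assumes M_nz: "M u1 u2 \<noteq> 0" and D_nz: "D u1 u2 \<noteq> 0"
begin

text \<open>
  \<open>W1\<close> and \<open>W2\<close> have squared length \<open>M\<^sup>2\<close>, being \<open>M\<close> times a reflected unit vector.
\<close>

lemma W_nonzero: "W1 u1 u2 \<noteq> 0" "W2 u1 u2 \<noteq> 0"
proof -
  have e1: "axial_dir \<bullet> V u1 u2 = deriv f u1" and e2: "angular_dir u2 \<bullet> V u1 u2 = deriv g u2"
    by (simp_all add: V_eq inner_simps cylinder_frame_orthonormal
        inner_commute[of "angular_dir u2" axial_dir])
  have "W1 u1 u2 \<bullet> W1 u1 u2 = (M u1 u2)^2" "W2 u1 u2 \<bullet> W2 u1 u2 = (M u1 u2)^2"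
    using D_nz
    by (simp_all add: W1_def W2_def inner_simps cylinder_frame_orthonormal V_inner_V e1 e2
        inner_commute[of "V u1 u2"] power2_eq_square field_simps)
  then show "W1 u1 u2 \<noteq> 0" "W2 u1 u2 \<noteq> 0"
    using M_nz by auto
qed

text \<open>
  Differentiating \<open>2 / D\<close> produces the \<open>V\<close>-component of \<open>W1\<close>; the axial component has
  the matching factor since \<open>D - 2 (b + c f) = - c M\<close>. In the angular direction the
  corresponding identity is \<open>D - 2 (b - c g) = c M\<close>, whence the opposite sign.
\<close>

lemma partial1_tilde_surface:
  "partial1 (tilde_surface b c f g) u1 u2 = (- c / D u1 u2) *\<^sub>R W1 u1 u2"
proof -
  have coeff: "((\<lambda>t. 2 / (2*b + c * (f t - g u2))) has_real_derivative
      - (2 * c * deriv f u1) / (D u1 u2)^2) (at u1)"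
    using D_nz unfolding D_def
    by (auto intro!: derivative_eq_intros f_deriv simp: power2_eq_square)
  have "1 - (2 / D u1 u2) * (b + c * f u1) = - c / D u1 u2 * M u1 u2"
    using D_nz by (simp add: field_simps) (simp add: D_def M_def algebra_simps)
  from arg_cong[OF this, of "\<lambda>r. r *\<^sub>R axial_dir"]
  have axial: "axial_dir - (2 / D u1 u2) *\<^sub>R ((b + c * f u1) *\<^sub>R axial_dir)
      = (- c / D u1 u2) *\<^sub>R (M u1 u2 *\<^sub>R axial_dir)"
    by (simp only: scaleR_left_diff_distrib[of 1] scaleR_one scaleR_scaleR)
  have "((\<lambda>t. tilde_surface b c f g t u2) has_vector_derivative
      axial_dir - ((2 / D u1 u2) *\<^sub>R ((b + c * f u1) *\<^sub>R axial_dir)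
        + (- (2 * c * deriv f u1) / (D u1 u2)^2) *\<^sub>R V u1 u2)) (at u1)"
    unfolding tilde_surface_def
    using has_vector_derivative_diff[OF cyl_has_vector_derivative_axial
        has_vector_derivative_scaleR[OF coeff V_has_vector_derivative_1]]
    by (simp add: D_def)
  then show ?thesis
    unfolding partial1_def W1_def diff_diff_add[symmetric] axial
    by (subst vector_derivative_at, assumption)
       (simp add: scaleR_diff_right power2_eq_square)
qed

lemma partial2_tilde_surface:
  "partial2 (tilde_surface b c f g) u1 u2 = (c / D u1 u2) *\<^sub>R W2 u1 u2"
proof -
  have coeff: "((\<lambda>t. 2 / (2*b + c * (f u1 - g t))) has_real_derivative
      (2 * c * deriv g u2) / (D u1 u2)^2) (at u2)"
    using D_nz unfolding D_def
    by (auto intro!: derivative_eq_intros g_deriv simp: power2_eq_square)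
  have "1 - (2 / D u1 u2) * (b - c * g u2) = c / D u1 u2 * M u1 u2"
    using D_nz by (simp add: field_simps) (simp add: D_def M_def algebra_simps)
  from arg_cong[OF this, of "\<lambda>r. r *\<^sub>R angular_dir u2"]
  have angular: "angular_dir u2 - (2 / D u1 u2) *\<^sub>R ((b - c * g u2) *\<^sub>R angular_dir u2)
      = (c / D u1 u2) *\<^sub>R (M u1 u2 *\<^sub>R angular_dir u2)"
    by (simp only: scaleR_left_diff_distrib[of 1] scaleR_one scaleR_scaleR)
  have "((\<lambda>t. tilde_surface b c f g u1 t) has_vector_derivative
      angular_dir u2 - ((2 / D u1 u2) *\<^sub>R ((b - c * g u2) *\<^sub>R angular_dir u2)
        + ((2 * c * deriv g u2) / (D u1 u2)^2) *\<^sub>R V u1 u2)) (at u2)"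
    unfolding tilde_surface_def
    using has_vector_derivative_diff[OF cyl_has_vector_derivative_angular
        has_vector_derivative_scaleR[OF coeff V_has_vector_derivative_2]]
    by (simp add: D_def)
  then show ?thesis
    unfolding partial2_def W2_def diff_diff_add[symmetric] angular
    by (subst vector_derivative_at, assumption)
       (simp add: scaleR_diff_right power2_eq_square)
qed

text \<open>
  The normal of the cylinder is constant along the rulings, so only the multiple of \<open>V\<close>
  contributes; the factor of \<open>W1\<close> emerges because \<open>(D M)\<^sub>,\<^sub>1 = 2 f' (b + c f)\<close> contains the
  factor \<open>b + c f\<close> of \<open>V\<^sub>,\<^sub>1\<close>.
\<close>

lemma partial1_tilde_normal:
  "partial1 (tilde_normal b c f g) u1 u2
    = (2 * g u2 * (b + c * f u1) / (D u1 u2 * (M u1 u2)^2)) *\<^sub>R W1 u1 u2"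
proof -
  let ?k = "2 * g u2 * (b + c * f u1) / (D u1 u2 * (M u1 u2)^2)"
  have denom: "((\<lambda>t. (2*b + c * (f t - g u2)) * (f t + g u2)) has_real_derivative
      2 * deriv f u1 * (b + c * f u1)) (at u1)"
    by (auto intro!: derivative_eq_intros f_deriv simp: algebra_simps)
  have "((\<lambda>t. 2 * g u2 / ((2*b + c * (f t - g u2)) * (f t + g u2))) has_real_derivative
      (0 * (D u1 u2 * M u1 u2) - 2 * g u2 * (2 * deriv f u1 * (b + c * f u1)))
        / ((D u1 u2 * M u1 u2) * (D u1 u2 * M u1 u2))) (at u1)"
    using M_nz D_nz unfolding M_def D_def
    by (intro DERIV_divide denom DERIV_const) simp
  moreover have "(0 * (D u1 u2 * M u1 u2) - 2 * g u2 * (2 * deriv f u1 * (b + c * f u1)))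
        / ((D u1 u2 * M u1 u2) * (D u1 u2 * M u1 u2)) = - (?k * (2 * deriv f u1 / D u1 u2))"
    using M_nz D_nz by (simp add: power2_eq_square ac_simps)
  ultimately have coeff: "((\<lambda>t. 2 * g u2 / ((2*b + c * (f t - g u2)) * (f t + g u2)))
      has_real_derivative - (?k * (2 * deriv f u1 / D u1 u2))) (at u1)"
    by simp
  have axial: "(2 * g u2 / (D u1 u2 * M u1 u2)) * (b + c * f u1) = ?k * M u1 u2"
    using M_nz D_nz by (simp add: power2_eq_square)
  have "((\<lambda>t. tilde_normal b c f g t u2) has_vector_derivative
      0 + ((2 * g u2 / (D u1 u2 * M u1 u2)) *\<^sub>R ((b + c * f u1) *\<^sub>R axial_dir)
        + (- (?k * (2 * deriv f u1 / D u1 u2))) *\<^sub>R V u1 u2)) (at u1)"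
    unfolding tilde_normal_def
    using has_vector_derivative_add[OF cyl_normal_has_vector_derivative_axial
        has_vector_derivative_scaleR[OF coeff V_has_vector_derivative_1]]
    by (simp add: D_def M_def)
  then show ?thesis
    unfolding partial1_def W1_def scaleR_scaleR axial
    by (subst vector_derivative_at, assumption) (simp add: scaleR_diff_right)
qed

text \<open>
  Here \<open>N\<^sub>,\<^sub>2 = - X\<^sub>,\<^sub>2\<close> and the derivative of the numerator \<open>2 g\<close> join in. They fit the pattern
  because both carry the summand \<open>D M\<close> that completes \<open>2 g (b - c g)\<close> to the stated factor.
\<close>

lemma partial2_tilde_normal:
  "partial2 (tilde_normal b c f g) u1 u2
    = (- (D u1 u2 * M u1 u2 - 2 * g u2 * (b - c * g u2)) / (D u1 u2 * (M u1 u2)^2)) *\<^sub>R W2 u1 u2"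
proof -
  let ?k = "- (D u1 u2 * M u1 u2 - 2 * g u2 * (b - c * g u2)) / (D u1 u2 * (M u1 u2)^2)"
  have denom: "((\<lambda>t. (2*b + c * (f u1 - g t)) * (f u1 + g t)) has_real_derivative
      2 * deriv g u2 * (b - c * g u2)) (at u2)"
    by (auto intro!: derivative_eq_intros g_deriv simp: algebra_simps)
  have "((\<lambda>t. 2 * g t / ((2*b + c * (f u1 - g t)) * (f u1 + g t))) has_real_derivative
      (2 * deriv g u2 * (D u1 u2 * M u1 u2) - 2 * g u2 * (2 * deriv g u2 * (b - c * g u2)))
        / ((D u1 u2 * M u1 u2) * (D u1 u2 * M u1 u2))) (at u2)"
    using M_nz D_nz unfolding M_def D_def
    by (intro DERIV_divide denom DERIV_cmult g_deriv) simp
  moreover have "(2 * deriv g u2 * (D u1 u2 * M u1 u2)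
        - 2 * g u2 * (2 * deriv g u2 * (b - c * g u2)))
        / ((D u1 u2 * M u1 u2) * (D u1 u2 * M u1 u2)) = - (?k * (2 * deriv g u2 / D u1 u2))"
    using M_nz D_nz by (simp add: power2_eq_square divide_simps) (simp add: algebra_simps)
  ultimately have coeff: "((\<lambda>t. 2 * g t / ((2*b + c * (f u1 - g t)) * (f u1 + g t)))
      has_real_derivative - (?k * (2 * deriv g u2 / D u1 u2))) (at u2)"
    by simp
  have "-1 + (2 * g u2 / (D u1 u2 * M u1 u2)) * (b - c * g u2) = ?k * M u1 u2"
    using M_nz D_nz by (simp add: power2_eq_square divide_simps)
  from arg_cong[OF this, of "\<lambda>r. r *\<^sub>R angular_dir u2"]
  have angular: "- angular_dir u2
      + (2 * g u2 / (D u1 u2 * M u1 u2)) *\<^sub>R ((b - c * g u2) *\<^sub>R angular_dir u2)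
      = ?k *\<^sub>R (M u1 u2 *\<^sub>R angular_dir u2)"
    by (simp only: scaleR_left_distrib scaleR_minus1_left scaleR_scaleR)
  have "((\<lambda>t. tilde_normal b c f g u1 t) has_vector_derivative
      - angular_dir u2 + ((2 * g u2 / (D u1 u2 * M u1 u2)) *\<^sub>R ((b - c * g u2) *\<^sub>R angular_dir u2)
        + (- (?k * (2 * deriv g u2 / D u1 u2))) *\<^sub>R V u1 u2)) (at u2)"
    unfolding tilde_normal_def
    using has_vector_derivative_add[OF cyl_normal_has_vector_derivative_angular
        has_vector_derivative_scaleR[OF coeff V_has_vector_derivative_2]]
    by (simp add: D_def M_def)
  then show ?thesis
    unfolding partial2_def W2_def add.assoc[symmetric] angular
    by (subst vector_derivative_at, assumption)
       (simp only: scaleR_diff_right scaleR_scaleR scaleR_minus_left add_uminus_conv_diff)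
qed

section \<open>The mean curvature\<close>

text \<open>
  Over the common denominator \<open>c M\<^sup>2\<close>, the numerators of the two principal curvatures add up
  to \<open>- M (c M + 2 b)\<close>, so the
  deviation from \<open>- 1/2\<close> is proportional to \<open>b\<close>.
\<close>

lemma tilde_mean_curvature:
  "mean_curvature (tilde_surface b c f g) (tilde_normal b c f g) u1 u2
    = - 1/2 - b / (c * M u1 u2)"
proof -
  have "principal_curvature1 (tilde_surface b c f g) (tilde_normal b c f g) u1 u2
      = (2 * g u2 * (b + c * f u1) / (D u1 u2 * (M u1 u2)^2)) / (- c / D u1 u2)"
    unfolding principal_curvature1_def partial1_tilde_surface partial1_tilde_normal
    using c_nonzero D_nz by (intro the_scaleR_ratio W_nonzero) simp
  also have "\<dots> = - (2 * g u2 * (b + c * f u1)) / (c * (M u1 u2)^2)"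
    using c_nonzero D_nz by simp
  finally have l1: "principal_curvature1 (tilde_surface b c f g) (tilde_normal b c f g) u1 u2
      = - (2 * g u2 * (b + c * f u1)) / (c * (M u1 u2)^2)" .
  have "principal_curvature2 (tilde_surface b c f g) (tilde_normal b c f g) u1 u2
      = (- (D u1 u2 * M u1 u2 - 2 * g u2 * (b - c * g u2)) / (D u1 u2 * (M u1 u2)^2))
        / (c / D u1 u2)"
    unfolding principal_curvature2_def partial2_tilde_surface partial2_tilde_normal
    using c_nonzero D_nz by (intro the_scaleR_ratio W_nonzero) simp
  also have "\<dots> = - (D u1 u2 * M u1 u2 - 2 * g u2 * (b - c * g u2)) / (c * (M u1 u2)^2)"
    using c_nonzero D_nz by simp
  finally have l2: "principal_curvature2 (tilde_surface b c f g) (tilde_normal b c f g) u1 u2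
      = - (D u1 u2 * M u1 u2 - 2 * g u2 * (b - c * g u2)) / (c * (M u1 u2)^2)" .
  have "2 * g u2 * (b + c * f u1) + (D u1 u2 * M u1 u2 - 2 * g u2 * (b - c * g u2))
      = M u1 u2 * (c * M u1 u2 + 2 * b)"
    by (simp add: D_def M_def algebra_simps)
  moreover have sum_quotients: "- p / q + - r / q = - (p + r) / q" for p q r :: real
    by (simp only: add_divide_distrib[symmetric] minus_add_distrib)
  ultimately have "mean_curvature (tilde_surface b c f g) (tilde_normal b c f g) u1 u2
      = - (M u1 u2 * (c * M u1 u2 + 2 * b)) / (2 * (c * (M u1 u2)^2))"
    unfolding mean_curvature_def l1 l2 sum_quotients by simp
  also have "\<dots> = - 1/2 - b / (c * M u1 u2)"
    using c_nonzero M_nz by (simp add: power2_eq_square field_simps)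
  finally show ?thesis .
qed

end

end

theorem corollary2p4:
  fixes b c :: real and f g :: "real \<Rightarrow> real"
  assumes "c \<noteq> 0"
    and "solves_ode2 (- c) b f"
    and "solves_ode2 (1 + c) b g"
    and "\<exists>u1 u2. (deriv f u1)^2 - c * (f u1)^2 - 2 * b * f u1
               + (deriv g u2)^2 + (1 + c) * (g u2)^2 - 2 * b * g u2 = 0"
    and "tilde_domain b c f g \<noteq> {}"
  shows "(\<forall>(u1, u2) \<in> tilde_domain b c f g.
            mean_curvature (tilde_surface b c f g) (tilde_normal b c f g) u1 u2 = - 1/2)
         \<longleftrightarrow> b = 0"
proof -
  interpret cylinder_isothermic_data b c f g
    using assms(1-4) by unfold_locales
  have "mean_curvature (tilde_surface b c f g) (tilde_normal b c f g) u1 u2 = - 1/2 \<longleftrightarrow> b = 0"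
    if "(u1, u2) \<in> tilde_domain b c f g" for u1 u2
  proof -
    have nz: "M u1 u2 \<noteq> 0" "D u1 u2 \<noteq> 0"
      using that by (auto simp: tilde_domain_def M_def D_def)
    show ?thesis
      using nz(1) c_nonzero by (simp add: tilde_mean_curvature[OF nz])
  qed
  with assms(5) show ?thesis
    by fast
qed

end
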